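(* For any (probabilistic bounded error or deterministic) symbolic algorithm that solves $\mathrm{Safe}(T)$, and likewise for any that solves $\text{coBüchi}(T)$, the following lower bounds on the required number of symbolic one-step operations hold: (1) $\Omega(n)$ even for constant diameter graphs; (2) $\Omega(|T|)$ even for constant diameter graphs; and (3) $\omega\big(\sum_{C\in SCCs(G)}(D_C+1)\big)$ even for constant diameter graphs.
   Context: Symbolic model: the input is a finite directed graph $G=(V,E)$ (self-loops allowed), $n=|V|$, together with a starting vertex $s\in V$ and a set $T\subseteq V$ of safe vertices. The algorithm knows $V$, $s$, $T$, but it can access $E$ only through the one-step operations $\mathrm{Pre}(S)=\{v\in V\mid \exists s'\in S:(v,s')\in E\}$ and $\mathrm{Post}(S)=\{v\in V\mid \exists s'\in S:(s',v)\in E\}$ applied to (adaptively chosen) sets $S\subseteq V$. All other computation, in particular basic set operations on vertex sets, is unrestricted and not counted in lower bounds; any number of sets may be stored. A probabilistic bounded error algorithm may use random bits and must be correct with probability at least $2/3$ on every (admissible) input. $\mathrm{Safe}(T)$: decide whether there is an infinite path in $G$ starting from $s$ that only visits vertices of $T$. $\text{coBüchi}(T)$ (co-liveness): decide whether there is an infinite path in $G$ starting from $s$ that eventually only visits vertices of $T$. Convention for lower bounds: a lower bound $\Omega(g)$, for a parameter $g$ of the input, means: there is an absolute constant $c>0$ such that every (deterministic or probabilistic bounded error) symbolic algorithm solving the problem performs, on inputs with arbitrarily large $g$, at least $c\cdot g$ one-step operations (worst case over its random choices). A lower bound $\omega(g)$ means: for every constant $K>0$ and every such algorithm there is an input on which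 it performs more than $K\cdot g$ one-step operations (worst case over its random choices), i.e. no algorithm uses $O(g)$ one-step operations. "Even for constant diameter graphs" means that, for some fixed constant $d_0$, this already holds when the algorithm need only be correct on graphs of diameter at most $d_0$, the hard inputs having diameter at most $d_0$. The diameter of $G$ is the largest finite distance: the maximum of $d(u,v)$ over all pairs $u,v$ such that $u$ can reach $v$, where $d(u,v)$ is the smallest number of edges on a path from $u$ to $v$. $SCCs(G)$ is the set of strongly connected components of $G$, and $D_C$ is the diameter of (the subgraph induced by) the component $C$. *)

theory Defs
  imports "HOL-Probability.Probability"
begin

section \<open>Graphs\<close>

text \<open>
  Vertices are natural numbers, so that every finite directed graph occurs up to renaming; a graph is
  given by its vertex set \<open>V\<close> and its edge relation \<open>E \<subseteq> V \<times> V\<close>, self-loops allowed.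
\<close>

type_synonym edges = "(nat \<times> nat) set"

definition distance :: "edges \<Rightarrow> nat \<Rightarrow> nat \<Rightarrow> nat" where
  "distance E u v = (LEAST k. (u, v) \<in> E ^^ k)"

text \<open>Only pairs with \<open>u\<close> reaching \<open>v\<close> count: this is the largest finite distance.\<close>

definition diameter :: "nat set \<Rightarrow> edges \<Rightarrow> nat" where
  "diameter V E = Max {distance E u v | u v. u \<in> V \<and> v \<in> V \<and> (u, v) \<in> E\<^sup>*}"

definition SCCs :: "nat set \<Rightarrow> edges \<Rightarrow> nat set set" where
  "SCCs V E = V // {(u, v). (u, v) \<in> E\<^sup>* \<and> (v, u) \<in> E\<^sup>*}"

definition component_diameter :: "edges \<Rightarrow> nat set \<Rightarrow> nat" where
  "component_diameter E C = diameter C (E \<inter> C \<times> C)"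

definition Pre :: "edges \<Rightarrow> nat set \<Rightarrow> nat set" where
  "Pre E S = {v. \<exists>s'\<in>S. (v, s') \<in> E}"

definition Post :: "edges \<Rightarrow> nat set \<Rightarrow> nat set" where
  "Post E S = {v. \<exists>s'\<in>S. (s', v) \<in> E}"


section \<open>Inputs and decision problems\<close>

record input =
  verts :: "nat set"
  edges :: edges
  start :: nat
  safe  :: "nat set"

definition valid_input :: "input \<Rightarrow> bool" where
  "valid_input I \<longleftrightarrow> finite (verts I) \<and> edges I \<subseteq> verts I \<times> verts I
     \<and> start I \<in> verts I \<and> safe I \<subseteq> verts I"

definition inputs_of_diameter :: "nat \<Rightarrow> input set" where
  "inputs_of_diameter d = {I. valid_input I \<and> diameter (verts I) (edges I) \<le> d}"

definition infinite_path :: "edges \<Rightarrow> nat \<Rightarrow> (nat \<Rightarrow> nat) \<Rightarrow> bool" where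
  "infinite_path E s p \<longleftrightarrow> p 0 = s \<and> (\<forall>i. (p i, p (Suc i)) \<in> E)"

definition Safe :: "input \<Rightarrow> bool" where
  "Safe I \<longleftrightarrow> (\<exists>p. infinite_path (edges I) (start I) p \<and> (\<forall>i. p i \<in> safe I))"

definition coBuchi :: "input \<Rightarrow> bool" where
  "coBuchi I \<longleftrightarrow> (\<exists>p. infinite_path (edges I) (start I) p \<and> (\<exists>N. \<forall>i\<ge>N. p i \<in> safe I))"


section \<open>Symbolic algorithms\<close>

text \<open>
  A computation is a possibly infinite strategy tree. A node either halts with an answer, performs a
  one-step operation and continues depending on the returned set, or draws a random bit. All other
  computation and all stored sets are absorbed into the (arbitrary) continuation functions. Since
  \<open>E \<subseteq> V \<times> V\<close>, vertices outside \<open>V\<close> in an argument \<open>S\<close> have no effect.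
\<close>

codatatype computation =
    Halt bool
  | PreOp "nat set" "nat set \<Rightarrow> computation"
  | PostOp "nat set" "nat set \<Rightarrow> computation"
  | Flip "bool \<Rightarrow> computation"

text \<open>An algorithm is told \<open>V\<close>, \<open>s\<close> and \<open>T\<close>, but not \<open>E\<close>.\<close>

type_synonym algorithm = "nat set \<Rightarrow> nat \<Rightarrow> nat set \<Rightarrow> computation"

definition start_computation :: "algorithm \<Rightarrow> input \<Rightarrow> computation" where
  "start_computation A I = A (verts I) (start I) (safe I)"

text \<open>
  A configuration consists of the remaining computation, the unused random bits, and the number of
  one-step operations performed so far.
\<close>

type_synonym config = "computation \<times> bool stream \<times> nat"

fun step :: "edges \<Rightarrow> config \<Rightarrow> config" where
  "step E (Halt b, \<omega>, k) = (Halt b, \<omega>, k)"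
| "step E (PreOp S f, \<omega>, k) = (f (Pre E S), \<omega>, Suc k)"
| "step E (PostOp S f, \<omega>, k) = (f (Post E S), \<omega>, Suc k)"
| "step E (Flip f, \<omega>, k) = (f (shd \<omega>), stl \<omega>, k)"

definition config_after :: "edges \<Rightarrow> computation \<Rightarrow> bool stream \<Rightarrow> nat \<Rightarrow> config" where
  "config_after E a \<omega> m = (step E ^^ m) (a, \<omega>, 0)"

definition outputs :: "algorithm \<Rightarrow> input \<Rightarrow> bool stream \<Rightarrow> bool \<Rightarrow> bool" where
  "outputs A I \<omega> b \<longleftrightarrow>
     (\<exists>m. fst (config_after (edges I) (start_computation A I) \<omega> m) = Halt b)"

text \<open>Number of one-step operations in the worst case over the random bits.\<close>

definition one_step_ops :: "algorithm \<Rightarrow> input \<Rightarrow> enat" where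
  "one_step_ops A I =
     (SUP \<omega>. SUP m. enat (snd (snd (config_after (edges I) (start_computation A I) \<omega> m))))"

definition coin_space :: "bool stream measure" where
  "coin_space = stream_space (measure_pmf (bernoulli_pmf (1/2)))"

coinductive flip_free :: "computation \<Rightarrow> bool" where
  "flip_free (Halt b)"
| "(\<And>R. flip_free (f R)) \<Longrightarrow> flip_free (PreOp S f)"
| "(\<And>R. flip_free (f R)) \<Longrightarrow> flip_free (PostOp S f)"

definition solves_deterministically :: "algorithm \<Rightarrow> (input \<Rightarrow> bool) \<Rightarrow> input set \<Rightarrow> bool" where
  "solves_deterministically A P \<I> \<longleftrightarrow>
     (\<forall>V s T. flip_free (A V s T)) \<and> (\<forall>I\<in>\<I>. \<forall>\<omega>. outputs A I \<omega> (P I))"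

definition solves_with_bounded_error :: "algorithm \<Rightarrow> (input \<Rightarrow> bool) \<Rightarrow> input set \<Rightarrow> bool" where
  "solves_with_bounded_error A P \<I> \<longleftrightarrow>
     (\<forall>I\<in>\<I>. measure coin_space {\<omega>. outputs A I \<omega> (P I)} \<ge> 2/3)"

text \<open>
  The event of a given answer is measurable for every algorithm, so the probability bound above
  carries no hidden measurability condition.
\<close>

lemma measurable_halts_after:
  "Measurable.pred coin_space (\<lambda>\<omega>. fst ((step E ^^ m) (a, \<omega>, k)) = Halt b)"
proof (induction m arbitrary: a k)
  case 0
  show ?case by simp
next
  case (Suc m)
  have stl: "stl \<in> measurable coin_space coin_space"
    unfolding coin_space_def by (rule measurable_stl)
  have shd: "Measurable.pred coin_space shd"
    unfolding coin_space_def
    by (rule measurable_compose[OF measurable_shd]) simp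
  have "Measurable.pred coin_space (\<lambda>\<omega>. fst ((step E ^^ m) (step E (a, \<omega>, k))) = Halt b)"
  proof (cases a)
    case (Flip f)
    have *: "Measurable.pred coin_space (\<lambda>\<omega>. fst ((step E ^^ m) (f c, stl \<omega>, k)) = Halt b)" for c
      by (rule measurable_compose[OF stl Suc.IH])
    have "Measurable.pred coin_space
            (\<lambda>\<omega>. (shd \<omega> \<longrightarrow> fst ((step E ^^ m) (f True, stl \<omega>, k)) = Halt b) \<and>
                 (\<not> shd \<omega> \<longrightarrow> fst ((step E ^^ m) (f False, stl \<omega>, k)) = Halt b))"
      by (intro pred_intros_logic shd *)
    also have "(\<lambda>\<omega>. (shd \<omega> \<longrightarrow> fst ((step E ^^ m) (f True, stl \<omega>, k)) = Halt b) \<and>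
                 (\<not> shd \<omega> \<longrightarrow> fst ((step E ^^ m) (f False, stl \<omega>, k)) = Halt b))
             = (\<lambda>\<omega>. fst ((step E ^^ m) (f (shd \<omega>), stl \<omega>, k)) = Halt b)"
      by (rule ext) (metis (full_types))
    finally show ?thesis by (simp add: Flip)
  qed (simp_all add: Suc.IH)
  then show ?case by (simp add: funpow_swap1)
qed

lemma measurable_outputs: "{\<omega>. outputs A I \<omega> b} \<in> sets coin_space"
proof -
  have "Measurable.pred coin_space (\<lambda>\<omega>. outputs A I \<omega> b)"
    unfolding outputs_def config_after_def
    by (intro pred_intros_countable measurable_halts_after)
  then show ?thesis
    by (simp add: pred_def coin_space_def space_stream_space)
qed


section \<open>Lower bounds\<close>

definition solves :: "algorithm \<Rightarrow> (input \<Rightarrow> bool) \<Rightarrow> input set \<Rightarrow> bool" where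
  "solves A P \<I> \<longleftrightarrow> solves_deterministically A P \<I> \<or> solves_with_bounded_error A P \<I>"

text \<open>
  \<open>\<Omega>(g)\<close> and \<open>\<omega>(g)\<close> lower bounds, even for constant diameter graphs: for a fixed \<open>d\<close>, the algorithm
  need only be correct on graphs of diameter at most \<open>d\<close>, and the hard inputs have diameter at most \<open>d\<close>.
\<close>

definition Omega_bound_const_diameter :: "(input \<Rightarrow> bool) \<Rightarrow> (input \<Rightarrow> nat) \<Rightarrow> bool" where
  "Omega_bound_const_diameter P g \<longleftrightarrow>
     (\<exists>d. \<exists>c::real. c > 0 \<and>
        (\<forall>A. solves A P (inputs_of_diameter d) \<longrightarrow>
           (\<forall>N. \<exists>I\<in>inputs_of_diameter d.
              g I \<ge> N \<and> ereal_of_enat (one_step_ops A I) \<ge> ereal (c * real (g I)))))"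

definition omega_bound_const_diameter :: "(input \<Rightarrow> bool) \<Rightarrow> (input \<Rightarrow> nat) \<Rightarrow> bool" where
  "omega_bound_const_diameter P g \<longleftrightarrow>
     (\<exists>d. \<forall>K::real. K > 0 \<longrightarrow>
        (\<forall>A. solves A P (inputs_of_diameter d) \<longrightarrow>
           (\<exists>I\<in>inputs_of_diameter d.
              ereal_of_enat (one_step_ops A I) > ereal (K * real (g I)))))"

end

theory Submission
  imports Defs
begin

text \<open>
  Take the transitive tournament on \<open>0 < \<dots> < n\<close>, add edges from the unsafe vertex \<open>n\<close> to all
  vertices, and add self-loops at a set \<open>X\<close> of safe vertices. The graph is strongly connected of
  diameter at most 2, and a safe infinite path exists iff \<open>X \<noteq> {}\<close>. Since all vertices below the
  maximum of \<open>S\<close> belong to \<open>Pre S\<close> anyway, \<open>Pre S\<close> reveals at most whether that maximum carries a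
  loop; likewise \<open>Post S\<close> and the minimum. So, for every outcome of the coins, a run with \<open>q\<close>
  operations on the loop-free graph coincides with the runs for \<open>X = {i}\<close> for all but at most \<open>q\<close>
  vertices \<open>i\<close>. On the other hand, for each \<open>i < n\<close> the answers for \<open>X = {}\<close> and \<open>X = {i}\<close> are both
  correct with probability at least \<open>1/3\<close>. Summing over \<open>i\<close> gives \<open>q \<ge> n/3\<close>.
\<close>

section \<open>The hard inputs: diameter, components and answers\<close>

definition loop_edges :: "nat \<Rightarrow> nat set \<Rightarrow> edges" where
  "loop_edges n X = {(u, v). u \<le> n \<and> v \<le> n \<and> (u < v \<or> u = n \<or> u = v \<and> u \<in> X)}"

definition loop_input :: "nat \<Rightarrow> nat set \<Rightarrow> input" where
  "loop_input n X = \<lparr>verts = {..n}, edges = loop_edges n X, start = 0, safe = {..<n}\<rparr>"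

lemma loop_input_simps [simp]:
  "verts (loop_input n X) = {..n}" "edges (loop_input n X) = loop_edges n X"
  "start (loop_input n X) = 0" "safe (loop_input n X) = {..<n}"
  by (simp_all add: loop_input_def)

lemma valid_loop_input: "valid_input (loop_input n X)"
  by (auto simp: valid_input_def loop_edges_def)

text \<open>The unsafe vertex \<open>n\<close> is a hub: every vertex, \<open>n\<close> included,
  has an edge to it and an edge from it.\<close>

lemma loop_edges_via_top:
  assumes "u \<le> n" "v \<le> n"
  shows "(u, v) \<in> loop_edges n X ^^ 2"
proof -
  have "(u, n) \<in> loop_edges n X" "(n, v) \<in> loop_edges n X"
    using assms by (auto simp: loop_edges_def)
  then show ?thesis
    by (auto simp: numeral_2_eq_2)
qed

lemma diameter_loop_edges: "diameter {..n} (loop_edges n X) \<le> 2"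
proof -
  define D where "D = {distance (loop_edges n X) u v | u v.
    u \<in> {..n} \<and> v \<in> {..n} \<and> (u, v) \<in> (loop_edges n X)\<^sup>*}"
  have "D \<subseteq> {..2}"
    unfolding D_def distance_def by (auto intro!: Least_le loop_edges_via_top)
  moreover from this have "finite D"
    by (rule finite_subset) simp
  moreover have "D \<noteq> {}"
    unfolding D_def by blast
  ultimately have "Max D \<le> 2"
    by auto
  then show ?thesis
    by (simp add: diameter_def D_def)
qed

lemma loop_input_in_inputs_of_diameter: "loop_input n X \<in> inputs_of_diameter 2"
  by (simp add: inputs_of_diameter_def valid_loop_input diameter_loop_edges)

lemma SCCs_loop_edges: "SCCs {..n} (loop_edges n X) = {{..n}}"
proof -
  have conn: "(u, v) \<in> (loop_edges n X)\<^sup>*" if "u \<le> n" "v \<le> n" for u v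
    using loop_edges_via_top[OF that] by (rule relpow_imp_rtrancl)
  \<comment> \<open>The relation in \<open>SCCs\<close> lives on all naturals, so each class must be
    shown to stay inside \<open>{..n}\<close>.\<close>
  have closed: "v \<le> n" if "(u, v) \<in> (loop_edges n X)\<^sup>*" "u \<le> n" for u v
    using that by (induction rule: rtrancl_induct) (auto simp: loop_edges_def)
  define R where "R = {(u, v). (u, v) \<in> (loop_edges n X)\<^sup>* \<and> (v, u) \<in> (loop_edges n X)\<^sup>*}"
  have "v \<in> R `` {u} \<longleftrightarrow> v \<in> {..n}" if "u \<le> n" for u v
    unfolding R_def Image_singleton_iff mem_Collect_eq case_prod_conv atMost_iff
    using conn closed that by metis
  then have "R `` {u} = {..n}" if "u \<le> n" for u
    using that by blast
  then have "{..n} // R = {{..n}}"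
    unfolding quotient_def by auto
  then show ?thesis
    by (simp add: SCCs_def R_def)
qed

lemma component_diameters_loop_edges:
  "(\<Sum>C\<in>SCCs {..n} (loop_edges n X). (component_diameter (loop_edges n X) C + 1)) \<le> 3"
proof -
  have "loop_edges n X \<inter> {..n} \<times> {..n} = loop_edges n X"
    by (auto simp: loop_edges_def)
  then show ?thesis
    using diameter_loop_edges[of n X] by (simp add: SCCs_loop_edges component_diameter_def)
qed

lemma Safe_imp_coBuchi: "Safe I \<Longrightarrow> coBuchi I"
  by (auto simp: Safe_def coBuchi_def)

lemma Safe_loop_input:
  assumes "i \<in> X" "i < n"
  shows "Safe (loop_input n X)"
proof -
  \<comment> \<open>Go from 0 to \<open>i\<close> in one edge, then repeat the loop; for
    \<open>i = 0\<close> the first edge is already the loop.\<close>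
  have "infinite_path (loop_edges n X) 0 (\<lambda>k. if k = 0 then 0 else i)"
    using assms by (auto simp: infinite_path_def loop_edges_def)
  then show ?thesis
    unfolding Safe_def using assms by (auto intro!: exI[of _ "\<lambda>k. if k = 0 then 0 else i"])
qed

text \<open>Without loops, edges leaving safe vertices strictly increase, so no infinite tail stays
  below \<open>n\<close>. Refuting the weaker condition \<open>coBuchi\<close> refutes
  \<open>Safe\<close> as well.\<close>

lemma not_coBuchi_loop_input: "\<not> coBuchi (loop_input n {})"
proof
  assume "coBuchi (loop_input n {})"
  then obtain p N where p: "\<And>k. (p k, p (Suc k)) \<in> loop_edges n {}"
    and safe: "\<And>k. k \<ge> N \<Longrightarrow> p k < n"
    by (auto simp: coBuchi_def infinite_path_def)
  have "p (N + k) \<ge> k" for k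
  proof (induction k)
    case (Suc k)
    then show ?case
      using p[of "N + k"] safe[of "N + k"] by (auto simp: loop_edges_def)
  qed simp
  from this[of n] safe[of "N + n"] show False
    by simp
qed

section \<open>How much one operation reveals about the loop\<close>

lemma loop_edges_singleton: "i < n \<Longrightarrow> loop_edges n {i} = insert (i, i) (loop_edges n {})"
  by (auto simp: loop_edges_def)

text \<open>The loop can only add \<open>i\<close> itself to the result, and any larger vertex of
  \<open>S\<close> up to \<open>n\<close> is a successor of \<open>i\<close> that puts it there
  already. Hence \<open>S\<close> determines \<open>i\<close>.\<close>

lemma Pre_loop_edges_differ:
  assumes "i < n" "Pre (loop_edges n {i}) S \<noteq> Pre (loop_edges n {}) S"
  shows "i \<in> S \<and> (\<forall>v\<in>S. v \<le> n \<longrightarrow> v \<le> i)"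
proof -
  have "Pre (loop_edges n {i}) S = Pre (loop_edges n {}) S \<union> ({i} \<inter> S)"
    using loop_edges_singleton[OF assms(1)] by (auto simp: Pre_def)
  with assms(2) have "i \<in> S" "i \<notin> Pre (loop_edges n {}) S"
    by auto
  then show ?thesis
    using assms(1) by (auto simp: Pre_def loop_edges_def not_le[symmetric])
qed

lemma Post_loop_edges_differ:
  assumes "i < n" "Post (loop_edges n {i}) S \<noteq> Post (loop_edges n {}) S"
  shows "i \<in> S \<and> (\<forall>v\<in>S. v \<le> n \<longrightarrow> i \<le> v)"
proof -
  have "Post (loop_edges n {i}) S = Post (loop_edges n {}) S \<union> ({i} \<inter> S)"
    using loop_edges_singleton[OF assms(1)] by (auto simp: Post_def)
  with assms(2) have "i \<in> S" "i \<notin> Post (loop_edges n {}) S"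
    by auto
  then show ?thesis
    using assms(1) by (auto simp: Post_def loop_edges_def not_le[symmetric])
qed

text \<open>Two indices in \<open>J\<close> would both be the maximum (for \<open>Pre\<close>) or
  minimum (for \<open>Post\<close>) of the queried set within the graph, so each operation pays for
  at most one index. Halting and coin flips do not consult the edges.\<close>

lemma card_step_differ:
  fixes n :: nat and c :: config
  defines "J \<equiv> {i. i < n \<and> step (loop_edges n {i}) c \<noteq> step (loop_edges n {}) c}"
  shows "card J + snd (snd c) \<le> snd (snd (step (loop_edges n {}) c))"
proof -
  obtain a \<omega> k where c: "c = (a, \<omega>, k)"
    by (cases c)
  show ?thesis
  proof (cases a)
    case (PreOp S f)
    have differ: "u < n \<and> Pre (loop_edges n {u}) S \<noteq> Pre (loop_edges n {}) S" if "u \<in> J" for u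
      using that by (auto simp: J_def c PreOp)
    have "u = v" if "u \<in> J" "v \<in> J" for u v
      using differ[OF that(1)] differ[OF that(2)] Pre_loop_edges_differ
      by (meson le_antisym less_imp_le)
    moreover have "finite J"
      by (simp add: J_def)
    ultimately have "card J \<le> Suc 0"
      by (simp add: card_le_Suc0_iff_eq)
    then show ?thesis by (simp add: c PreOp)
  next
    case (PostOp S f)
    have differ: "u < n \<and> Post (loop_edges n {u}) S \<noteq> Post (loop_edges n {}) S" if "u \<in> J" for u
      using that by (auto simp: J_def c PostOp)
    have "u = v" if "u \<in> J" "v \<in> J" for u v
      using differ[OF that(1)] differ[OF that(2)] Post_loop_edges_differ
      by (meson le_antisym less_imp_le)
    moreover have "finite J"
      by (simp add: J_def)
    ultimately have "card J \<le> Suc 0"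
      by (simp add: card_le_Suc0_iff_eq)
    then show ?thesis by (simp add: c PostOp)
  qed (simp_all add: J_def c)
qed

lemma card_config_after_differ:
  "card {i. i < n \<and> config_after (loop_edges n {i}) a \<omega> m \<noteq> config_after (loop_edges n {}) a \<omega> m}
     \<le> snd (snd (config_after (loop_edges n {}) a \<omega> m))"
proof (induction m)
  case 0
  show ?case by (simp add: config_after_def)
next
  case (Suc m)
  define c where "c X = config_after (loop_edges n X) a \<omega> m" for X
  have Suc_m: "config_after (loop_edges n X) a \<omega> (Suc m) = step (loop_edges n X) (c X)" for X
    by (simp add: config_after_def c_def)
  let ?J = "{i. i < n \<and> c {i} \<noteq> c {}}"
  let ?J' = "{i. i < n \<and> step (loop_edges n {i}) (c {}) \<noteq> step (loop_edges n {}) (c {})}"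
  \<comment> \<open>An index is either separated already or gets separated by a step from the shared
    configuration \<open>c {}\<close>.\<close>
  have "card {i. i < n \<and> step (loop_edges n {i}) (c {i}) \<noteq> step (loop_edges n {}) (c {})}
      \<le> card (?J \<union> ?J')"
    by (rule card_mono) auto
  also have "\<dots> \<le> card ?J + card ?J'"
    by (rule card_Un_le)
  also have "\<dots> \<le> snd (snd (step (loop_edges n {}) (c {})))"
    using Suc.IH card_step_differ[of n "c {}"] by (simp add: c_def)
  finally show ?case
    by (simp add: Suc_m)
qed

section \<open>From configurations to answers, for fixed coins\<close>

lemma config_after_halted:
  assumes "fst (config_after E a \<omega> m) = Halt b" "m \<le> m'"
  shows "fst (config_after E a \<omega> m') = Halt b"
  using assms(2)
proof (induction m' rule: dec_induct)
  case base
  show ?case by (fact assms(1))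
next
  case (step m')
  then show ?case
    by (cases "config_after E a \<omega> m'") (auto simp: config_after_def)
qed

lemma outputs_unique:
  assumes "outputs A I \<omega> b" "outputs A I \<omega> b'"
  shows "b = b'"
proof -
  obtain m m' where
    "fst (config_after (edges I) (start_computation A I) \<omega> m) = Halt b"
    "fst (config_after (edges I) (start_computation A I) \<omega> m') = Halt b'"
    using assms by (auto simp: outputs_def)
  then have
    "fst (config_after (edges I) (start_computation A I) \<omega> (max m m')) = Halt b"
    "fst (config_after (edges I) (start_computation A I) \<omega> (max m m')) = Halt b'"
    by (auto intro: config_after_halted)
  then show ?thesis by simp
qed

lemma card_distinguished_loops:
  assumes ops: "one_step_ops A (loop_input n {}) \<le> enat q"
  shows "card {i. i < n \<and> outputs A (loop_input n {}) \<omega> False \<and> outputs A (loop_input n {i}) \<omega> True} \<le> q"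
proof (cases "outputs A (loop_input n {}) \<omega> False")
  case True
  define a where "a = A {..n} 0 {..<n}"
  \<comment> \<open>The set \<open>X\<close> enters only through the edges, which the algorithm is
    not told.\<close>
  have start: "start_computation A (loop_input n X) = a" for X
    by (simp add: start_computation_def a_def)
  obtain m where m: "fst (config_after (loop_edges n {}) a \<omega> m) = Halt False"
    using True by (auto simp: outputs_def start)
  have "outputs A (loop_input n {i}) \<omega> False"
    if "config_after (loop_edges n {i}) a \<omega> m = config_after (loop_edges n {}) a \<omega> m" for i
    using that m by (auto simp: outputs_def start intro!: exI[of _ m])
  \<comment> \<open>A run agreeing with the loop-free one at time \<open>m\<close> has also answered
    \<open>False\<close>, so answering \<open>True\<close> requires a different
    configuration.\<close>
  then have "card {i. i < n \<and> outputs A (loop_input n {}) \<omega> False \<and> outputs A (loop_input n {i}) \<omega> True}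
    \<le> card {i. i < n \<and> config_after (loop_edges n {i}) a \<omega> m \<noteq> config_after (loop_edges n {}) a \<omega> m}"
    by (intro card_mono) (auto dest: outputs_unique)
  also have "\<dots> \<le> snd (snd (config_after (loop_edges n {}) a \<omega> m))"
    by (rule card_config_after_differ)
  also have "\<dots> \<le> q"
  proof -
    have "enat (snd (snd (config_after (loop_edges n {}) a \<omega> m))) \<le> one_step_ops A (loop_input n {})"
      unfolding one_step_ops_def loop_input_simps start
      by (rule SUP_upper2[where i = \<omega>], simp, rule SUP_upper2[where i = m]) simp_all
    with ops show ?thesis
      by (metis enat_ord_simps(1) order_trans)
  qed
  finally show ?thesis .
qed simp

section \<open>Averaging over the coins\<close>

interpretation coin_space: prob_space coin_space
  unfolding coin_space_def
  by (rule prob_space.prob_space_stream_space) (rule prob_space_measure_pmf)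

lemma space_coin_space: "space coin_space = UNIV"
  by (simp add: coin_space_def space_stream_space)

text \<open>Deterministic correctness holds for all coins, hence with probability 1; both kinds of
  algorithm can then be treated alike.\<close>

lemma solves_imp_prob:
  assumes "solves A P \<I>" "I \<in> \<I>"
  shows "coin_space.prob {\<omega>. outputs A I \<omega> (P I)} \<ge> 2/3"
proof (cases "solves_with_bounded_error A P \<I>")
  case False
  with assms have "{\<omega>. outputs A I \<omega> (P I)} = space coin_space"
    by (auto simp: solves_def solves_deterministically_def space_coin_space)
  then show ?thesis
    by (simp add: coin_space.prob_space)
qed (use assms in \<open>simp add: solves_with_bounded_error_def\<close>)

lemma one_step_ops_loop_input:
  assumes P: "P \<in> {Safe, coBuchi}" and A: "solves A P (inputs_of_diameter 2)"
  shows "ereal_of_enat (one_step_ops A (loop_input n {})) \<ge> ereal (real n / 3)"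
proof (cases "one_step_ops A (loop_input n {})")
  case (enat q)
  define F where "F = {\<omega>. outputs A (loop_input n {}) \<omega> False}"
  define T where "T i = {\<omega>. outputs A (loop_input n {i}) \<omega> True}" for i
  have [measurable]: "F \<in> sets coin_space" "T i \<in> sets coin_space" for i
    unfolding F_def T_def by (rule measurable_outputs)+
  have "\<not> P (loop_input n {})"
    using P not_coBuchi_loop_input Safe_imp_coBuchi by auto
  then have F: "coin_space.prob F \<ge> 2/3"
    using solves_imp_prob[OF A loop_input_in_inputs_of_diameter, of n "{}"] by (simp add: F_def)
  \<comment> \<open>Inclusion-exclusion: 2/3 + 2/3 - 1 = 1/3.\<close>
  have "coin_space.prob (F \<inter> T i) \<ge> 1/3" if "i < n" for i
  proof -
    have "P (loop_input n {i})"
      using P Safe_loop_input[of i "{i}" n] Safe_imp_coBuchi that by auto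
    then have "coin_space.prob (T i) \<ge> 2/3"
      using solves_imp_prob[OF A loop_input_in_inputs_of_diameter, of n "{i}"] by (simp add: T_def)
    moreover have "coin_space.prob (F \<union> T i) = coin_space.prob F + coin_space.prob (T i) - coin_space.prob (F \<inter> T i)"
      by (intro measure_Un3) (auto simp: fmeasurable_def less_top[symmetric])
    moreover have "coin_space.prob (F \<union> T i) \<le> 1"
      by simp
    ultimately show ?thesis
      using F by linarith
  qed
  then have "real n / 3 \<le> (\<Sum>i<n. coin_space.prob (F \<inter> T i))"
    using sum_mono[of "{..<n}" "\<lambda>_. 1/3 :: real" "\<lambda>i. coin_space.prob (F \<inter> T i)"] by simp
  \<comment> \<open>This is the expected number of indices told apart from the loop-free graph, a
    number bounded by \<open>q\<close> for every outcome.\<close>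
  also have "\<dots> = coin_space.expectation (\<lambda>\<omega>. \<Sum>i<n. indicator (F \<inter> T i) \<omega>)"
    by (subst Bochner_Integration.integral_sum)
       (auto simp: space_coin_space less_top[symmetric])
  also have "\<dots> \<le> coin_space.expectation (\<lambda>\<omega>. real q)"
  proof (rule integral_mono)
    fix \<omega>
    have "{..<n} \<inter> {i. \<omega> \<in> F \<inter> T i} =
        {i. i < n \<and> outputs A (loop_input n {}) \<omega> False \<and> outputs A (loop_input n {i}) \<omega> True}"
      by (auto simp: F_def T_def)
    then have "card ({..<n} \<inter> {i. \<omega> \<in> F \<inter> T i}) \<le> q"
      using card_distinguished_loops[of A n q \<omega>] enat by simp
    moreover have "(\<Sum>i<n. indicator (F \<inter> T i) \<omega> :: real) = card ({..<n} \<inter> {i. \<omega> \<in> F \<inter> T i})"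
      by (simp add: indicator_def sum.If_cases flip: of_bool_def)
    ultimately show "(\<Sum>i<n. indicator (F \<inter> T i) \<omega>) \<le> real q"
      by simp
  qed (auto simp: less_top[symmetric])
  also have "\<dots> = real q"
    by (simp add: coin_space.prob_space)
  finally show ?thesis
    by (simp add: enat)
qed simp

section \<open>The three lower bounds\<close>

lemma Omega_bound_loop_input:
  assumes P: "P \<in> {Safe, coBuchi}"
    and g: "\<And>n. n \<le> g (loop_input n {})" "\<And>n. g (loop_input n {}) \<le> n + 1"
  shows "Omega_bound_const_diameter P g"
  unfolding Omega_bound_const_diameter_def
proof (intro exI conjI allI impI)
  fix A N
  assume A: "solves A P (inputs_of_diameter 2)"
  let ?I = "loop_input (Suc N) {}"
  have "ereal (1/6 * real (g ?I)) \<le> ereal (real (Suc N) / 3)"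
    using g(2)[of "Suc N"] by simp
  also have "\<dots> \<le> ereal_of_enat (one_step_ops A ?I)"
    by (rule one_step_ops_loop_input[OF P A])
  finally show "\<exists>I\<in>inputs_of_diameter 2. g I \<ge> N \<and> ereal_of_enat (one_step_ops A I) \<ge> ereal (1/6 * real (g I))"
    using g(1)[of "Suc N"] by (intro bexI[OF _ loop_input_in_inputs_of_diameter]) auto
qed simp

lemma omega_bound_loop_input:
  assumes P: "P \<in> {Safe, coBuchi}" and g: "\<And>n. g (loop_input n {}) \<le> b"
  shows "omega_bound_const_diameter P g"
  unfolding omega_bound_const_diameter_def
proof (intro exI allI impI)
  fix K :: real and A
  assume K: "K > 0" and A: "solves A P (inputs_of_diameter 2)"
  \<comment> \<open>While \<open>g\<close> stays below \<open>b\<close> on the whole family, the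
    cost grows as \<open>n / 3\<close>, so a large \<open>n\<close> beats any
    \<open>K\<close>.\<close>
  obtain n :: nat where n: "3 * (K * real b) < real n"
    using reals_Archimedean2 by blast
  have "K * real (g (loop_input n {})) \<le> K * real b"
    using K g by simp
  also have "\<dots> < real n / 3"
    using n by simp
  finally have "ereal (K * real (g (loop_input n {}))) < ereal (real n / 3)"
    by simp
  also have "\<dots> \<le> ereal_of_enat (one_step_ops A (loop_input n {}))"
    by (rule one_step_ops_loop_input[OF P A])
  finally show "\<exists>I\<in>inputs_of_diameter 2. ereal_of_enat (one_step_ops A I) > ereal (K * real (g I))"
    by (intro bexI[OF _ loop_input_in_inputs_of_diameter])
qed

theorem theorem3p11:
  assumes "P \<in> {Safe, coBuchi}"
  shows "Omega_bound_const_diameter P (\<lambda>I. card (verts I))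
       \<and> Omega_bound_const_diameter P (\<lambda>I. card (safe I))
       \<and> omega_bound_const_diameter P
           (\<lambda>I. \<Sum>C\<in>SCCs (verts I) (edges I). (component_diameter (edges I) C + 1))"
proof (intro conjI)
  show "Omega_bound_const_diameter P (\<lambda>I. card (verts I))"
    by (rule Omega_bound_loop_input[OF assms]) simp_all
  show "Omega_bound_const_diameter P (\<lambda>I. card (safe I))"
    by (rule Omega_bound_loop_input[OF assms]) simp_all
  show "omega_bound_const_diameter P
      (\<lambda>I. \<Sum>C\<in>SCCs (verts I) (edges I). (component_diameter (edges I) C + 1))"
    by (rule omega_bound_loop_input[OF assms, where b = 3])
       (simp only: loop_input_simps component_diameters_loop_edges)
qed

end
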